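(* Let $\mathcal{C}$ be the Cayley algebra over an algebraically closed field $\mathbb{F}$ of characteristic not two, let $\{xyz\}=(x\bar y)z$, and let $\Gamma^{\mathcal{C}}_{\mathrm{CD}}$ be the fine $(\mathbb{Z}/2)^4$-grading of $(\mathcal{C},\{...\})$ attached to a CD-basis. Identify $\mathbb{Z}/2$ with the field $\mathbb{F}_2$ of two elements, and embed the Weyl group $W(\Gamma^{\mathcal{C}}_{\mathrm{CD}})$ in $\{\gamma\in\mathrm{GL}(\mathbb{F}_2^4)\mid\gamma(1\times\mathbb{F}_2^3)\subseteq1\times\mathbb{F}_2^3\}$, which is identified with the affine group $\mathrm{Aff}(3,\mathbb{F}_2)$. Then $W(\Gamma^{\mathcal{C}}_{\mathrm{CD}})$ is the whole affine group $\mathrm{Aff}(3,\mathbb{F}_2)$.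
   Context: A Cayley algebra is an eight-dimensional unital nonassociative algebra with a nondegenerate multiplicative quadratic form $n$; over an algebraically closed field it is unique up to isomorphism. $n(x,y)=n(x+y)-n(x)-n(y)$, $\bar x=n(x,1)1-x$. $\mathrm{Aut}(\mathcal{C},\{...\})$ is the group of linear automorphisms of $\mathcal{C}$ preserving the triple product $\{...\}$. CD-basis $\{1,w_1,\dots,w_7\}$ of $\mathcal{C}$: $w_i^2=-1$, $w_iw_{i+1}=-w_{i+1}w_i=w_{i+3}$, cyclically in $i,i+1,i+3$ (indices mod $7$). $\Gamma^{\mathcal{C}}_{\mathrm{CD}}$ is the $(\mathbb{Z}/2)^4$-grading on $(\mathcal{C},\{...\})$ (i.e. $\{\mathcal{C}_a\mathcal{C}_b\mathcal{C}_c\}\subseteq\mathcal{C}_{a+b+c}$) whose nonzero homogeneous components are the lines spanned by the elements of the CD-basis, determined by $\deg(1)=(\bar1,\bar0,\bar0,\bar0)$, $\deg(w_1)=(\bar1,\bar1,\bar0,\bar0)$, $\deg(w_2)=(\bar1,\bar0,\bar1,\bar0)$, $\deg(w_3)=(\bar1,\bar0,\bar0,\bar1)$. Its support is $1\times\mathbb{F}_2^3$ and its universal grading group is $(\mathbb{Z}/2)^4$. The Weyl group $W(\Gamma)$ of a grading $\Gamma$ is the quotient of the group of elements of $\mathrm{Aut}(\mathcal{C},\{...\})$ permuting the homogeneous components of $\Gamma$ by the subgroup of those mapping each homogeneous component to itself. Each element of $W(\Gamma^{\mathcal{C}}_{\mathrm{CD}})$ permutes the support and this permutation extends to an automorphism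 of the universal group $(\mathbb{Z}/2)^4$, which gives the embedding in the claim. *)

theory Defs
  imports
    "HOL-Analysis.Cartesian_Space"
    "HOL-Algebra.Coset"
    "HOL-Library.Z2"
    "HOL-Computational_Algebra.Polynomial"
begin

section \<open>Cayley algebras\<close>

definition polar :: "('c::ab_group_add \<Rightarrow> 'f::field) \<Rightarrow> 'c \<Rightarrow> 'c \<Rightarrow> 'f" where
  "polar n x y = n (x + y) - n x - n y"

locale cayley_algebra = vector_space smul
  for smul :: "'f::field \<Rightarrow> 'c::ab_group_add \<Rightarrow> 'c" +
  fixes mul :: "'c \<Rightarrow> 'c \<Rightarrow> 'c"
    and unit :: 'c
    and n :: "'c \<Rightarrow> 'f"
  assumes linear_mul_left: "Vector_Spaces.linear smul smul (\<lambda>x. mul x y)"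
    and linear_mul_right: "Vector_Spaces.linear smul smul (\<lambda>y. mul x y)"
    and mul_unit_left: "mul unit x = x"
    and mul_unit_right: "mul x unit = x"
    and dim_eight: "dim UNIV = 8"
    and norm_scale: "n (smul a x) = a\<^sup>2 * n x"
    and linear_polar: "Vector_Spaces.linear smul (*) (\<lambda>x. polar n x y)"
    and nondegenerate: "(\<And>y. polar n x y = 0) \<Longrightarrow> x = 0"
    and norm_mul: "n (mul x y) = n x * n y"

definition cayley_conj :: "('f::field \<Rightarrow> 'c::ab_group_add \<Rightarrow> 'c) \<Rightarrow> 'c \<Rightarrow> ('c \<Rightarrow> 'f) \<Rightarrow> 'c \<Rightarrow> 'c" where
  "cayley_conj smul unit n x = smul (polar n x unit) unit - x"

definition cayley_triple ::
  "('f::field \<Rightarrow> 'c::ab_group_add \<Rightarrow> 'c) \<Rightarrow> ('c \<Rightarrow> 'c \<Rightarrow> 'c) \<Rightarrow> 'c \<Rightarrow> ('c \<Rightarrow> 'f)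
    \<Rightarrow> 'c \<Rightarrow> 'c \<Rightarrow> 'c \<Rightarrow> 'c" where
  "cayley_triple smul mul unit n x y z = mul (mul x (cayley_conj smul unit n y)) z"

text \<open>
  The index type \<open>7\<close> is the ring of integers modulo \<open>7\<close>, so \<open>w 7 = w 0\<close>. The last six
  equations are \<open>w\<^sub>i w\<^sub>i\<^sub>+\<^sub>1 = - w\<^sub>i\<^sub>+\<^sub>1 w\<^sub>i = w\<^sub>i\<^sub>+\<^sub>3\<close> and its
  images under the cyclic permutations of \<open>(i, i + 1, i + 3)\<close>.
\<close>

definition CD_basis ::
  "('f::field \<Rightarrow> 'c::ab_group_add \<Rightarrow> 'c) \<Rightarrow> ('c \<Rightarrow> 'c \<Rightarrow> 'c) \<Rightarrow> 'c \<Rightarrow> (7 \<Rightarrow> 'c) \<Rightarrow> bool" where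
  "CD_basis smul mul unit w \<longleftrightarrow>
     inj w \<and> unit \<notin> range w \<and>
     \<not> module.dependent smul (insert unit (range w)) \<and>
     module.span smul (insert unit (range w)) = UNIV \<and>
     (\<forall>i. mul (w i) (w i) = - unit) \<and>
     (\<forall>i. mul (w i) (w (i + 1)) = w (i + 3) \<and> mul (w (i + 1)) (w i) = - w (i + 3) \<and>
          mul (w (i + 1)) (w (i + 3)) = w i \<and> mul (w (i + 3)) (w (i + 1)) = - w i \<and>
          mul (w (i + 3)) (w i) = w (i + 1) \<and> mul (w i) (w (i + 3)) = - w (i + 1))"


section \<open>Gradings on triple systems and their Weyl groups\<close>

definition direct_sum_decomposition ::
  "('f::field \<Rightarrow> 'c::ab_group_add \<Rightarrow> 'c) \<Rightarrow> ('g \<Rightarrow> 'c set) \<Rightarrow> bool" where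
  "direct_sum_decomposition smul \<Gamma> \<longleftrightarrow>
     (\<forall>a. module.subspace smul (\<Gamma> a)) \<and>
     (\<forall>x. \<exists>!f. (\<forall>a. f a \<in> \<Gamma> a) \<and> finite {a. f a \<noteq> 0} \<and> x = (\<Sum>a | f a \<noteq> 0. f a))"

definition grading ::
  "('f::field \<Rightarrow> 'c::ab_group_add \<Rightarrow> 'c) \<Rightarrow> ('c \<Rightarrow> 'c \<Rightarrow> 'c \<Rightarrow> 'c) \<Rightarrow> ('g::ab_group_add \<Rightarrow> 'c set) \<Rightarrow> bool"
  where
  "grading smul tri \<Gamma> \<longleftrightarrow>
     direct_sum_decomposition smul \<Gamma> \<and>
     (\<forall>a b c. \<forall>x\<in>\<Gamma> a. \<forall>y\<in>\<Gamma> b. \<forall>z\<in>\<Gamma> c. tri x y z \<in> \<Gamma> (a + b + c))"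

definition supp :: "('g \<Rightarrow> 'c::zero set) \<Rightarrow> 'g set" where
  "supp \<Gamma> = {a. \<Gamma> a \<noteq> {0}}"

definition components :: "('g \<Rightarrow> 'c::zero set) \<Rightarrow> 'c set set" where
  "components \<Gamma> = \<Gamma> ` supp \<Gamma>"

definition triple_automorphisms ::
  "('f::field \<Rightarrow> 'c::ab_group_add \<Rightarrow> 'c) \<Rightarrow> ('c \<Rightarrow> 'c \<Rightarrow> 'c \<Rightarrow> 'c) \<Rightarrow> ('c \<Rightarrow> 'c) set" where
  "triple_automorphisms smul tri =
     {\<phi>. Vector_Spaces.linear smul smul \<phi> \<and> bij \<phi> \<and>
         (\<forall>x y z. \<phi> (tri x y z) = tri (\<phi> x) (\<phi> y) (\<phi> z))}"

definition comp_group :: "('a \<Rightarrow> 'a) set \<Rightarrow> ('a \<Rightarrow> 'a) monoid" where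
  "comp_group S = \<lparr>carrier = S, monoid.mult = (\<circ>), one = id\<rparr>"

definition grading_automorphisms ::
  "('f::field \<Rightarrow> 'c::ab_group_add \<Rightarrow> 'c) \<Rightarrow> ('c \<Rightarrow> 'c \<Rightarrow> 'c \<Rightarrow> 'c) \<Rightarrow> ('g \<Rightarrow> 'c set) \<Rightarrow> ('c \<Rightarrow> 'c) set"
  where
  "grading_automorphisms smul tri \<Gamma> =
     {\<phi> \<in> triple_automorphisms smul tri. bij_betw (image \<phi>) (components \<Gamma>) (components \<Gamma>)}"

definition grading_stabilizer ::
  "('f::field \<Rightarrow> 'c::ab_group_add \<Rightarrow> 'c) \<Rightarrow> ('c \<Rightarrow> 'c \<Rightarrow> 'c \<Rightarrow> 'c) \<Rightarrow> ('g \<Rightarrow> 'c set) \<Rightarrow> ('c \<Rightarrow> 'c) set"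
  where
  "grading_stabilizer smul tri \<Gamma> =
     {\<phi> \<in> triple_automorphisms smul tri. \<forall>X\<in>components \<Gamma>. \<phi> ` X = X}"

definition weyl_group ::
  "('f::field \<Rightarrow> 'c::ab_group_add \<Rightarrow> 'c) \<Rightarrow> ('c \<Rightarrow> 'c \<Rightarrow> 'c \<Rightarrow> 'c) \<Rightarrow> ('g \<Rightarrow> 'c set)
    \<Rightarrow> ('c \<Rightarrow> 'c) set monoid" where
  "weyl_group smul tri \<Gamma> =
     comp_group (grading_automorphisms smul tri \<Gamma>) Mod grading_stabilizer smul tri \<Gamma>"


section \<open>The grading attached to a CD-basis\<close>

definition CD_grading ::
  "('f::field \<Rightarrow> 'c::ab_group_add \<Rightarrow> 'c) \<Rightarrow> ('c \<Rightarrow> 'c \<Rightarrow> 'c \<Rightarrow> 'c) \<Rightarrow> 'c \<Rightarrow> (7 \<Rightarrow> 'c)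
    \<Rightarrow> (bit ^ 4 \<Rightarrow> 'c set) \<Rightarrow> bool" where
  "CD_grading smul tri unit w \<Gamma> \<longleftrightarrow>
     grading smul tri \<Gamma> \<and>
     components \<Gamma> = (\<lambda>v. module.span smul {v}) ` insert unit (range w) \<and>
     unit \<in> \<Gamma> (vector [1, 0, 0, 0]) \<and>
     w 1 \<in> \<Gamma> (vector [1, 1, 0, 0]) \<and>
     w 2 \<in> \<Gamma> (vector [1, 0, 1, 0]) \<and>
     w 3 \<in> \<Gamma> (vector [1, 0, 0, 1])"

text \<open>
  Such a grading is automatically fine: no grading by any abelian group properly refines it.
\<close>

lemma CD_grading_fine:
  fixes smul :: "'f::field \<Rightarrow> 'c::ab_group_add \<Rightarrow> 'c"
    and \<Gamma>' :: "'h::ab_group_add \<Rightarrow> 'c set"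
  assumes "vector_space smul" and CD: "CD_grading smul tri unit w \<Gamma>"
    and gr: "grading smul tri \<Gamma>'"
    and X: "X \<in> components \<Gamma>'" and Y: "Y \<in> components \<Gamma>" and sub: "X \<subseteq> Y"
  shows "X = Y"
proof -
  interpret vector_space smul by fact
  obtain v where v: "Y = span {v}"
    using CD Y unfolding CD_grading_def by auto
  have sX: "subspace X" and "X \<noteq> {0}"
    using gr X by (auto simp: grading_def direct_sum_decomposition_def components_def supp_def)
  then obtain x where x: "x \<in> X" "x \<noteq> 0"
    using subspace_0 by blast
  then obtain k where k: "x = smul k v"
    using sub v by (auto simp: span_singleton)
  with x have "k \<noteq> 0" by auto
  then have "v = smul (inverse k) x" using k by simp
  then have "v \<in> X" using sX x(1) subspace_scale by blast
  then have "span {v} \<subseteq> X" using sX by (simp add: span_minimal)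
  with sub v show ?thesis by blast
qed


section \<open>The affine group and the embedding of the Weyl group\<close>

definition GL :: "('k::field ^ 'm \<Rightarrow> 'k ^ 'm) set" where
  "GL = {\<gamma>. Vector_Spaces.linear (*s) (*s) \<gamma> \<and> bij \<gamma>}"

definition Aff :: "('k::field ^ 'm \<Rightarrow> 'k ^ 'm) set" where
  "Aff = {f. \<exists>L\<in>GL. \<exists>b. f = (\<lambda>x. L x + b)}"

definition affine_slice :: "(bit ^ 4) set" where
  "affine_slice = {a. a $ 1 = 1}"

definition GL_slice :: "(bit ^ 4 \<Rightarrow> bit ^ 4) set" where
  "GL_slice = {\<gamma> \<in> GL. \<gamma> ` affine_slice \<subseteq> affine_slice}"

text \<open>
  The identification of \<open>GL_slice\<close> with \<open>Aff(3, \<bbbF>\<^sub>2)\<close> restricts \<open>\<gamma>\<close> to \<open>1 \<times> \<bbbF>\<^sub>2\<^sup>3\<close>.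
\<close>

definition to_slice :: "bit ^ 3 \<Rightarrow> bit ^ 4" where
  "to_slice x = vector [1, x $ 1, x $ 2, x $ 3]"

definition from_slice :: "bit ^ 4 \<Rightarrow> bit ^ 3" where
  "from_slice a = vector [a $ 2, a $ 3, a $ 4]"

definition slice_to_affine :: "(bit ^ 4 \<Rightarrow> bit ^ 4) \<Rightarrow> bit ^ 3 \<Rightarrow> bit ^ 3" where
  "slice_to_affine \<gamma> = from_slice \<circ> \<gamma> \<circ> to_slice"

text \<open>
  Elements of the Weyl group are cosets of automorphisms; all members of a coset permute the
  homogeneous components, and hence the degrees in the support, in the same way.
\<close>

definition extends_weyl_action ::
  "('k::field ^ 'm \<Rightarrow> 'c::zero set) \<Rightarrow> ('c \<Rightarrow> 'c) set \<Rightarrow> ('k ^ 'm \<Rightarrow> 'k ^ 'm) \<Rightarrow> bool" where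
  "extends_weyl_action \<Gamma> X \<gamma> \<longleftrightarrow>
     \<gamma> \<in> GL \<and> (\<forall>\<phi>\<in>X. \<forall>a\<in>supp \<Gamma>. \<phi> ` \<Gamma> a = \<Gamma> (\<gamma> a))"

definition weyl_embedding ::
  "('k::field ^ 'm \<Rightarrow> 'c::zero set) \<Rightarrow> ('c \<Rightarrow> 'c) set \<Rightarrow> 'k ^ 'm \<Rightarrow> 'k ^ 'm" where
  "weyl_embedding \<Gamma> X = (THE \<gamma>. extends_weyl_action \<Gamma> X \<gamma>)"

end

theory Submission
  imports Defs
begin

text \<open>
  Label the CD-basis by \<open>1 \<times> \<bbbF>\<^sub>2\<^sup>3\<close>. Up to sign the triple product of \<open>e\<^sub>a, e\<^sub>b, e\<^sub>c\<close> is
  \<open>e\<^sub>a\<^sub>+\<^sub>b\<^sub>+\<^sub>c\<close>, so an automorphism permuting the components permutes the labels compatibly with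
  sums of three labels, i.e. affinely. Conversely, the sign of the triple product depends only on
  \<open>a + b\<close> and \<open>b + c\<close>, so translations of the labels lift to automorphisms without any signs. A linear
  transvection changes the sign of \<open>e\<^sub>a e\<^sub>b\<close> by the polarization of a quadratic form \<open>q\<close>, and
  \<open>e\<^sub>a \<mapsto> (-1)\<^bsup>q(a)\<^esup> e\<^sub>\<tau>\<^sub>a\<close> is a lift of it. Translations and transvections generate the affine group.
\<close>

section \<open>Linear maps over the field with two elements\<close>

lemma vector_4 [simp]:
  "(vector [x, y, z, t] :: 'a::zero ^ 4) $ 1 = x"
  "(vector [x, y, z, t] :: 'a::zero ^ 4) $ 2 = y"
  "(vector [x, y, z, t] :: 'a::zero ^ 4) $ 3 = z"
  "(vector [x, y, z, t] :: 'a::zero ^ 4) $ 4 = t"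
  unfolding vector_def by simp_all

lemma vec4_eq_iff: "a = b \<longleftrightarrow> a $ 1 = b $ 1 \<and> a $ 2 = b $ 2 \<and> a $ 3 = b $ 3 \<and> a $ 4 = b $ 4"
  for a b :: "'a ^ 4"
  by (simp add: vec_eq_iff forall_4)

lemma vec3_eq_iff: "a = b \<longleftrightarrow> a $ 1 = b $ 1 \<and> a $ 2 = b $ 2 \<and> a $ 3 = b $ 3"
  for a b :: "'a ^ 3"
  by (simp add: vec_eq_iff forall_3)

lemma bit_add_self [simp]: "a + a = 0" for a :: bit
  by (cases a) simp_all

lemma bit_vec_add_self [simp]: "a + a = 0" for a :: "bit ^ 'm"
  by (simp add: vec_eq_iff)

lemma bit_vec_add_self_left [simp]: "a + (a + b) = b" for a :: "bit ^ 'm"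
  by (simp flip: add.assoc)

lemma bit_linear_iff:
  "Vector_Spaces.linear (*s) (*s) g \<longleftrightarrow> (\<forall>x y. g (x + y) = g x + g y)"
  for g :: "bit ^ 'm \<Rightarrow> bit ^ 'k"
proof
  assume add: "\<forall>x y. g (x + y) = g x + g y"
  have "g 0 = 0" using add[rule_format, of 0 0] by simp
  then have "g (c *s x) = c *s g x" for c x
    by (cases c) simp_all
  with add show "Vector_Spaces.linear (*s) (*s) g"
    by (simp add: Vector_Spaces.linear_iff vec.vector_space_axioms)
qed (simp add: Vector_Spaces.linear_iff)

lemma GL_bit_iff: "g \<in> GL \<longleftrightarrow> (\<forall>x y. g (x + y) = g x + g y) \<and> bij g" for g :: "bit ^ 'm \<Rightarrow> bit ^ 'm"
  by (simp add: GL_def bit_linear_iff)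

lemma inj_additive_in_GL:
  fixes g :: "bit ^ 'm \<Rightarrow> bit ^ 'm"
  assumes "\<And>x y. g (x + y) = g x + g y" and "inj g"
  shows "g \<in> GL"
  using assms by (auto simp: GL_def bit_linear_iff bij_def intro!: vec.linear_inj_imp_surj)

lemma affine_slice_odd_sum:
  "\<lbrakk>a \<in> affine_slice; b \<in> affine_slice; c \<in> affine_slice\<rbrakk> \<Longrightarrow> a + b + c \<in> affine_slice"
  by (simp add: affine_slice_def)

lemma GL_slice_iff:
  "g \<in> GL_slice \<longleftrightarrow> (\<forall>x y. g (x + y) = g x + g y) \<and> bij g \<and> (\<forall>x. g x $ 1 = x $ 1)"
proof -
  have "g x $ 1 = x $ 1"
    if add: "\<forall>x y. g (x + y) = g x + g y" and sl: "g ` affine_slice \<subseteq> affine_slice" for x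
  proof (cases "x $ 1")
    case zero
    let ?u = "vector [1, 0, 0, 0] :: bit ^ 4"
    have "g (x + ?u) \<in> affine_slice" "g ?u \<in> affine_slice"
      using zero by (intro sl[THEN subsetD, OF imageI]; simp add: affine_slice_def)+
    moreover have "g x = g (x + ?u) + g ?u"
      by (simp add: add.assoc flip: add[rule_format])
    ultimately show ?thesis using zero by (simp add: affine_slice_def)
  next
    case one
    then show ?thesis using sl by (auto simp: affine_slice_def)
  qed
  then show ?thesis
    by (auto simp: GL_slice_def GL_bit_iff affine_slice_def)
qed

lemma group_comp_group:
  assumes "id \<in> S" "\<And>f g. f \<in> S \<Longrightarrow> g \<in> S \<Longrightarrow> f \<circ> g \<in> S"
    and "\<And>f. f \<in> S \<Longrightarrow> \<exists>g\<in>S. g \<circ> f = id"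
  shows "group (comp_group S)"
  using assms by (intro groupI) (auto simp: comp_group_def comp_assoc)

lemma GL_slice_id: "id \<in> GL_slice"
  by (simp add: GL_slice_iff)

lemma GL_slice_comp: "\<lbrakk>g \<in> GL_slice; h \<in> GL_slice\<rbrakk> \<Longrightarrow> g \<circ> h \<in> GL_slice"
  by (simp add: GL_slice_iff bij_comp)

lemma GL_slice_inverse:
  assumes "g \<in> GL_slice"
  obtains h where "h \<in> GL_slice" "h \<circ> g = id" "g \<circ> h = id"
proof
  let ?h = "inv_into UNIV g"
  have g: "\<And>x y. g (x + y) = g x + g y" "bij g" "\<And>x. g x $ 1 = x $ 1"
    using assms by (auto simp: GL_slice_iff)
  show hg: "?h \<circ> g = id" and gh: "g \<circ> ?h = id"
    using g(2) by (simp_all add: bij_is_inj bij_is_surj surj_iff[THEN iffD1])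
  have "?h (x + y) = ?h x + ?h y" for x y
    by (metis g(1) gh hg comp_apply id_apply)
  moreover have "?h x $ 1 = x $ 1" for x
    by (metis g(3) gh comp_apply id_apply)
  ultimately show "?h \<in> GL_slice"
    by (simp add: GL_slice_iff g(2) bij_imp_bij_inv)
qed

lemma group_GL_slice: "group (comp_group GL_slice)"
  by (rule group_comp_group) (blast intro: GL_slice_id GL_slice_comp elim: GL_slice_inverse)+

lemma GL_slice_eqI:
  assumes g: "g \<in> GL_slice" and h: "h \<in> GL_slice" and eq: "\<And>a. a \<in> affine_slice \<Longrightarrow> g a = h a"
  shows "g = h"
proof
  fix x
  let ?u = "vector [1, 0, 0, 0] :: bit ^ 4"
  show "g x = h x"
  proof (cases "x \<in> affine_slice")
    case False
    then have "g (x + ?u) = h (x + ?u)" "g ?u = h ?u"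
      using eq by (auto simp: affine_slice_def)
    then show ?thesis using g h by (simp add: GL_slice_iff)
  qed (rule eq)
qed

lemma slice_permutation_extends:
  assumes slice: "\<And>a. a \<in> affine_slice \<Longrightarrow> p a \<in> affine_slice"
    and odd: "\<And>a b c. \<lbrakk>a \<in> affine_slice; b \<in> affine_slice; c \<in> affine_slice\<rbrakk>
                 \<Longrightarrow> p (a + b + c) = p a + p b + p c"
    and inj: "inj_on p affine_slice"
  shows "\<exists>g\<in>GL_slice. \<forall>a\<in>affine_slice. g a = p a"
proof -
  define u :: "bit ^ 4" where "u = vector [1, 0, 0, 0]"
  define g where "g x = (if x \<in> affine_slice then p x else p (x + u) + p u)" for x
  have u: "u \<in> affine_slice" by (simp add: u_def affine_slice_def)
  have sum_in: "x + y \<in> affine_slice \<longleftrightarrow> (x \<in> affine_slice \<longleftrightarrow> y \<notin> affine_slice)" for x y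
    by (cases "x $ 1"; cases "y $ 1") (simp_all add: affine_slice_def)
  have add: "g (x + y) = g x + g y" for x y
  proof -
    consider "x \<in> affine_slice" "y \<in> affine_slice" | "x \<in> affine_slice" "y \<notin> affine_slice"
      | "x \<notin> affine_slice" "y \<in> affine_slice" | "x \<notin> affine_slice" "y \<notin> affine_slice" by blast
    then show ?thesis
    proof cases
      case 1
      then show ?thesis using odd[OF _ _ u, of x y] sum_in by (simp add: g_def add_ac)
    next
      case 2
      then have "p (x + (y + u) + u) = p x + p (y + u) + p u"
        using sum_in u by (intro odd) auto
      then show ?thesis using 2 sum_in by (simp add: g_def add_ac)
    next
      case 3
      then have "p ((x + u) + y + u) = p (x + u) + p y + p u"
        using sum_in u by (intro odd) auto
      then show ?thesis using 3 sum_in by (simp add: g_def add_ac)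
    next
      case 4
      then have "p ((x + u) + (y + u) + u) = p (x + u) + p (y + u) + p u"
        using sum_in u by (intro odd) auto
      then show ?thesis using 4 sum_in by (simp add: g_def add_ac)
    qed
  qed
  have ker: "x = 0" if "g x = 0" for x
  proof (cases "x \<in> affine_slice")
    case True
    then have "p x = 0" "p x \<in> affine_slice" using that slice[of x] by (simp_all add: g_def)
    then show ?thesis by (simp add: affine_slice_def)
  next
    case False
    then have "p (x + u) + p u = 0" using that by (simp add: g_def)
    then have "p (x + u) = p u"
      by (metis add.right_neutral add.commute bit_vec_add_self_left)
    then have "x + u = u" using inj_onD[OF inj] False sum_in u by blast
    then show ?thesis by simp
  qed
  have "inj g"
  proof (rule injI)
    fix x y assume "g x = g y"
    then have "x + y = 0" using ker[of "x + y"] add by simp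
    then show "x = y" by (metis add.right_neutral bit_vec_add_self_left)
  qed
  then have "g \<in> GL" using add by (rule inj_additive_in_GL[rotated])
  moreover have "g ` affine_slice \<subseteq> affine_slice" using slice by (auto simp: g_def)
  ultimately have "g \<in> GL_slice" by (simp add: GL_slice_def)
  then show ?thesis by (auto simp: g_def intro!: bexI[of _ g])
qed

lemma from_slice_add: "from_slice (a + b) = from_slice a + from_slice b"
  by (simp add: from_slice_def vec3_eq_iff)

lemma from_to_slice [simp]: "from_slice (to_slice x) = x"
  by (simp add: from_slice_def to_slice_def vec3_eq_iff)

lemma to_slice_in [simp]: "to_slice x \<in> affine_slice"
  by (simp add: to_slice_def affine_slice_def)

lemma to_from_slice [simp]: "a \<in> affine_slice \<Longrightarrow> to_slice (from_slice a) = a"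
  by (simp add: from_slice_def to_slice_def affine_slice_def vec4_eq_iff)

lemma slice_to_affine_iso: "slice_to_affine \<in> iso (comp_group GL_slice) (comp_group Aff)"
proof -
  define inc :: "bit ^ 3 \<Rightarrow> bit ^ 4" where "inc x = vector [0, x $ 1, x $ 2, x $ 3]" for x
  have inc_add: "inc (x + y) = inc x + inc y" for x y
    by (simp add: inc_def vec4_eq_iff)
  have from_inc: "from_slice (inc x) = x" for x
    by (simp add: inc_def from_slice_def vec3_eq_iff)
  have inc_from: "inc (from_slice a) = a" if "a $ 1 = 0" for a
    using that by (simp add: inc_def from_slice_def vec4_eq_iff)
  have to_inc: "to_slice x = inc x + to_slice 0" for x
    by (simp add: inc_def to_slice_def vec4_eq_iff)
  have in_Aff: "slice_to_affine g \<in> Aff" if "g \<in> GL_slice" for g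
  proof -
    have g: "\<And>x y. g (x + y) = g x + g y" "bij g" "\<And>x. g x $ 1 = x $ 1"
      using that by (auto simp: GL_slice_iff)
    define L where "L = from_slice \<circ> g \<circ> inc"
    have "inj L"
    proof (rule injI)
      fix x y assume "L x = L y"
      then have "inc (from_slice (g (inc x))) = inc (from_slice (g (inc y)))" by (simp add: L_def)
      then have "g (inc x) = g (inc y)"
        using inc_from[of "g (inc _)"] g(3) by (simp add: inc_def)
      then show "x = y" using g(2) from_inc by (metis bij_pointE)
    qed
    then have "L \<in> GL"
      by (intro inj_additive_in_GL) (simp_all add: L_def inc_add g(1) from_slice_add)
    moreover have "slice_to_affine g = (\<lambda>x. L x + from_slice (g (to_slice 0)))"
    proof
      fix x show "slice_to_affine g x = L x + from_slice (g (to_slice 0))"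
        using to_inc[of x] by (simp add: slice_to_affine_def L_def g(1) from_slice_add)
    qed
    ultimately show ?thesis by (auto simp: Aff_def)
  qed
  have inj: "inj_on slice_to_affine GL_slice"
  proof (rule inj_onI)
    fix g h assume gh: "g \<in> GL_slice" "h \<in> GL_slice" "slice_to_affine g = slice_to_affine h"
    show "g = h"
    proof (rule GL_slice_eqI)
      fix a assume a: "a \<in> affine_slice"
      then have "g a \<in> affine_slice" "h a \<in> affine_slice"
        using gh by (auto simp: GL_slice_iff affine_slice_def)
      moreover have "from_slice (g a) = from_slice (h a)"
        using fun_cong[OF gh(3), of "from_slice a"] a by (simp add: slice_to_affine_def)
      ultimately show "g a = h a" by (metis to_from_slice)
    qed (use gh in auto)
  qed
  have surj: "\<exists>g\<in>GL_slice. slice_to_affine g = f" if f_Aff: "f \<in> Aff" for f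
  proof -
    obtain L b where L: "L \<in> GL" and f: "f = (\<lambda>x. L x + b)" using f_Aff by (auto simp: Aff_def)
    have "to_slice (x + y + z) = to_slice x + to_slice y + to_slice z" for x y z
      by (simp add: to_slice_def vec4_eq_iff)
    moreover have "f (x + y + z) = f x + f y + f z" for x y z
      using L by (simp add: f GL_bit_iff add_ac)
    ultimately have "\<exists>g\<in>GL_slice. \<forall>a\<in>affine_slice. g a = to_slice (f (from_slice a))"
    proof (intro slice_permutation_extends)
      show "inj_on (\<lambda>a. to_slice (f (from_slice a))) affine_slice"
      proof (rule inj_onI)
        fix a b' assume ab: "a \<in> affine_slice" "b' \<in> affine_slice"
          and "to_slice (f (from_slice a)) = to_slice (f (from_slice b'))"
        then have "f (from_slice a) = f (from_slice b')" by (metis from_to_slice)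
        then have "from_slice a = from_slice b'"
          using L by (simp add: f GL_bit_iff bij_def inj_eq)
        then show "a = b'" using ab by (metis to_from_slice)
      qed
    qed (simp_all add: from_slice_add)
    then show ?thesis
      by (auto simp: slice_to_affine_def fun_eq_iff intro!: bexI)
  qed
  have "slice_to_affine (g \<circ> h) = slice_to_affine g \<circ> slice_to_affine h" if "h \<in> GL_slice" for g h
  proof
    fix x
    have "h (to_slice x) \<in> affine_slice"
      using that to_slice_in[of x] by (simp add: GL_slice_iff affine_slice_def)
    then show "slice_to_affine (g \<circ> h) x = (slice_to_affine g \<circ> slice_to_affine h) x"
      by (simp add: slice_to_affine_def)
  qed
  then show ?thesis
    using in_Aff inj surj by (auto simp: iso_def hom_def bij_betw_def comp_group_def image_iff) metis
qed

section \<open>Generation by transvections\<close>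

definition transvection :: "bit \<Rightarrow> 4 \<Rightarrow> 4 \<Rightarrow> bit ^ 4 \<Rightarrow> bit ^ 4" where
  "transvection c i j a = (\<chi> k. if k = i then a $ i + c * a $ j else a $ k)"

lemma transvection_nth [simp]:
  "transvection c i j a $ k = (if k = i then a $ i + c * a $ j else a $ k)"
  by (simp add: transvection_def)

lemma transvection_involution: "i \<noteq> j \<Longrightarrow> transvection c i j (transvection c i j x) = x"
  by (auto simp: vec_eq_iff)

lemma transvection_GL_slice:
  assumes "i \<noteq> 1" "i \<noteq> j"
  shows "transvection c i j \<in> GL_slice"
proof -
  have "transvection c i j (x + y) = transvection c i j x + transvection c i j y" for x y
    unfolding vec_eq_iff by (auto simp: distrib_left add_ac)
  moreover have "bij (transvection c i j)"
    using assms by (intro involuntory_imp_bij transvection_involution)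
  ultimately show ?thesis using assms by (simp add: GL_slice_iff)
qed

lemma GL_slice_expand:
  assumes "g \<in> GL_slice"
  shows "g v = v $ 1 *s g (axis 1 1) + v $ 2 *s g (axis 2 1) + v $ 3 *s g (axis 3 1) + v $ 4 *s g (axis 4 1)"
proof -
  have "v = v $ 1 *s axis 1 1 + v $ 2 *s axis 2 1 + v $ 3 *s axis 3 1 + v $ 4 *s axis 4 1"
    by (simp add: vec4_eq_iff axis_def)
  then have "g v = g (v $ 1 *s axis 1 1 + v $ 2 *s axis 2 1 + v $ 3 *s axis 3 1 + v $ 4 *s axis 4 1)"
    by simp
  also have "Vector_Spaces.linear (*s) (*s) g"
    using assms by (simp add: GL_slice_iff bit_linear_iff)
  then have "g (v $ 1 *s axis 1 1 + v $ 2 *s axis 2 1 + v $ 3 *s axis 3 1 + v $ 4 *s axis 4 1) =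
    v $ 1 *s g (axis 1 1) + v $ 2 *s g (axis 2 1) + v $ 3 *s g (axis 3 1) + v $ 4 *s g (axis 4 1)"
    by (simp add: Vector_Spaces.linear_iff)
  finally show ?thesis .
qed

lemma GL_slice_eq_idI:
  assumes "g \<in> GL_slice" "g (axis 1 1) = axis 1 1" "g (axis 2 1) = axis 2 1"
    "g (axis 3 1) = axis 3 1" "g (axis 4 1) = axis 4 1"
  shows "g = id"
proof
  show "g v = id v" for v
    using GL_slice_expand[OF assms(1), of v] assms(2-) by (simp add: vec4_eq_iff axis_def)
qed

text \<open>Gaussian elimination on the columns of \<open>g\<close>; the matrix entries themselves serve as the
  coefficients of the transvections.\<close>

lemma GL_slice_transvection_induct:
  assumes "g \<in> GL_slice" and P_id: "P id"
    and step: "\<And>c i j h. \<lbrakk>i \<noteq> 1; i \<noteq> j; h \<in> GL_slice; P (transvection c i j \<circ> h)\<rbrakk> \<Longrightarrow> P h"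
  shows "P g"
proof -
  have step': "P h" if "h \<in> GL_slice" "i \<noteq> 1" "i \<noteq> j"
    and "transvection c i j \<circ> h \<in> GL_slice \<Longrightarrow> P (transvection c i j \<circ> h)" for c i j h
    using that by (blast intro: step GL_slice_comp transvection_GL_slice)
  let ?e = "\<lambda>i. axis i 1 :: bit ^ 4"
  have inj: "h x = h y \<longleftrightarrow> x = y" if "h \<in> GL_slice" for h x y
    using that by (simp add: GL_slice_iff bij_def inj_eq)
  have zero: "h 0 = 0" if "h \<in> GL_slice" for h
    using GL_slice_expand[OF that, of 0] by simp
  have first: "h x $ 1 = x $ 1" if "h \<in> GL_slice" for h x
    using that by (simp add: GL_slice_iff)
  have 4: "P h" if h: "h \<in> GL_slice" and e: "h (?e 1) = ?e 1" "h (?e 2) = ?e 2" "h (?e 3) = ?e 3" for h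
  proof -
    have 40: "h (?e 4) $ 4 = 1"
    proof (rule ccontr)
      assume "\<not> ?thesis"
      then have "h (h (?e 4)) = h (?e 4)"
        using GL_slice_expand[OF h, of "h (?e 4)"] first[OF h, of "?e 4"] e
        by (simp add: vec4_eq_iff axis_def)
      then have "h (?e 4) = ?e 4" using inj[OF h] by blast
      with \<open>\<not> ?thesis\<close> show False by simp
    qed
    show ?thesis
    proof (rule step'[OF h, where c = "h (?e 4) $ 2" and i = 2 and j = 4], simp_all,
      rule step'[where c = "h (?e 4) $ 3" and i = 3 and j = 4], simp_all)
      let ?h = "transvection (h (?e 4) $ 3) 3 4 \<circ> (transvection (h (?e 4) $ 2) 2 4 \<circ> h)"
      assume "?h \<in> GL_slice"
      then have "?h = id"
        using first[OF h, of "?e 4"] e 40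
        by (intro GL_slice_eq_idI) (simp_all add: vec4_eq_iff axis_def)
      then show "P ?h" using P_id by simp
    qed
  qed
  have 3: "P h" if h: "h \<in> GL_slice" and e: "h (?e 1) = ?e 1" "h (?e 2) = ?e 2"
    and 30: "h (?e 3) $ 3 = 1" for h
  proof (rule step'[OF h, where c = "h (?e 3) $ 2" and i = 2 and j = 3], simp_all,
      rule step'[where c = "h (?e 3) $ 4" and i = 4 and j = 3], simp_all)
    let ?h = "transvection (h (?e 3) $ 4) 4 3 \<circ> (transvection (h (?e 3) $ 2) 2 3 \<circ> h)"
    assume "?h \<in> GL_slice"
    then show "P ?h"
      using first[OF h, of "?e 3"] e 30 by (intro 4) (simp_all add: vec4_eq_iff axis_def)
  qed
  have 3: "P h" if h: "h \<in> GL_slice" and e: "h (?e 1) = ?e 1" "h (?e 2) = ?e 2" for h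
  proof (cases "h (?e 3) $ 3 = 1")
    case False
    have "h (?e 3) $ 4 = 1"
    proof (rule ccontr)
      assume "\<not> ?thesis"
      with False have "h (h (?e 3)) = h (?e 3)"
        using GL_slice_expand[OF h, of "h (?e 3)"] first[OF h, of "?e 3"] e
        by (simp add: vec4_eq_iff axis_def)
      then have "h (?e 3) = ?e 3" using inj[OF h] by blast
      with False show False by simp
    qed
    then show ?thesis
      using False h e
      by (intro step'[OF h, where c = 1 and i = 3 and j = 4] 3) (simp_all add: vec4_eq_iff axis_def)
  qed (use h e 3 in blast)
  have 2: "P h" if h: "h \<in> GL_slice" and e: "h (?e 1) = ?e 1"
    and 20: "h (?e 2) $ 2 = 1" for h
  proof (rule step'[OF h, where c = "h (?e 2) $ 3" and i = 3 and j = 2], simp_all,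
      rule step'[where c = "h (?e 2) $ 4" and i = 4 and j = 2], simp_all)
    let ?h = "transvection (h (?e 2) $ 4) 4 2 \<circ> (transvection (h (?e 2) $ 3) 3 2 \<circ> h)"
    assume "?h \<in> GL_slice"
    then show "P ?h"
      using first[OF h, of "?e 2"] e 20 by (intro 3) (simp_all add: vec4_eq_iff axis_def)
  qed
  have 2: "P h" if h: "h \<in> GL_slice" and e: "h (?e 1) = ?e 1" for h
  proof (cases "h (?e 2) $ 2 = 1")
    case False
    have "h (?e 2) \<noteq> h 0" using inj[OF h] by (metis axis_eq_0_iff zero_neq_one)
    then have "h (?e 2) $ 3 = 1 \<or> h (?e 2) $ 4 = 1"
      using False zero[OF h] first[OF h, of "?e 2"] by (auto simp: vec4_eq_iff axis_def)
    then show ?thesis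
    proof
      assume "h (?e 2) $ 3 = 1"
      then show ?thesis
        using False h e
        by (intro step'[OF h, where c = 1 and i = 2 and j = 3] 2) (simp_all add: vec4_eq_iff axis_def)
    next
      assume "h (?e 2) $ 4 = 1"
      then show ?thesis
        using False h e
        by (intro step'[OF h, where c = 1 and i = 2 and j = 4] 2) (simp_all add: vec4_eq_iff axis_def)
    qed
  qed (use h e 2 in blast)
  show ?thesis
  proof (rule step'[OF assms(1), where c = "g (?e 1) $ 2" and i = 2 and j = 1], simp_all,
      rule step'[where c = "g (?e 1) $ 3" and i = 3 and j = 1], simp_all,
      rule step'[where c = "g (?e 1) $ 4" and i = 4 and j = 1], simp_all)
    let ?h = "transvection (g (?e 1) $ 4) 4 1 \<circ>
      (transvection (g (?e 1) $ 3) 3 1 \<circ> (transvection (g (?e 1) $ 2) 2 1 \<circ> g))"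
    assume "?h \<in> GL_slice"
    then show "P ?h"
      using first[OF assms(1), of "?e 1"] by (intro 2) (simp_all add: vec4_eq_iff axis_def)
  qed
qed

section \<open>Sign exponents\<close>

definition sgn_bit :: "bit \<Rightarrow> 'c \<Rightarrow> 'c::ab_group_add" where
  "sgn_bit b x = (if b = 0 then x else - x)"

lemma sgn_bit_simps [simp]: "sgn_bit 0 x = x" "sgn_bit 1 x = - x"
  by (simp_all add: sgn_bit_def)

lemma sgn_bit_add: "sgn_bit (b + c) x = sgn_bit b (sgn_bit c x)"
  by (cases b; cases c) simp_all

text \<open>Label the CD-basis by \<open>\<bbbF>\<^sub>2\<^sup>3\<close>, namely \<open>w\<^sub>1, w\<^sub>2, w\<^sub>3\<close> by the unit vectors and \<open>1\<close> by \<open>0\<close>.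
  Then \<open>e\<^sub>a e\<^sub>b = \<plusminus> e\<^sub>a\<^sub>+\<^sub>b\<close>, and \<open>cocycle a b\<close> is the exponent of the sign as a polynomial over
  \<open>\<bbbF>\<^sub>2\<close>. Labels live in coordinates 2, 3, 4 of \<open>bit ^ 4\<close>; coordinate 1 is ignored.\<close>

definition cocycle :: "bit ^ 4 \<Rightarrow> bit ^ 4 \<Rightarrow> bit" where
  "cocycle a b = a $ 2 * b $ 2 + a $ 3 * b $ 2 + a $ 3 * b $ 3 + a $ 4 * b $ 2 + a $ 4 * b $ 3 + a $ 4 * b $ 4
     + a $ 2 * a $ 3 * b $ 4 + a $ 2 * a $ 4 * b $ 3 + a $ 3 * a $ 4 * b $ 2"

text \<open>The left-hand side is the sign exponent of \<open>(e\<^sub>a \<cdot> conj e\<^sub>b) \<cdot> e\<^sub>c\<close>, so the structure constants of the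
  triple product are invariant under translation of the labels.\<close>

lemma cocycle_triple:
  "cocycle a b + of_bool (b $ 2 \<noteq> 0 \<or> b $ 3 \<noteq> 0 \<or> b $ 4 \<noteq> 0) + cocycle (a + b) c
     = cocycle (a + b) (b + c)"
  unfolding cocycle_def vector_add_component
  by (cases "a $ 2"; cases "a $ 3"; cases "a $ 4"; cases "b $ 2"; cases "b $ 3"; cases "b $ 4";
      cases "c $ 2"; cases "c $ 3"; cases "c $ 4"; simp)

definition quad :: "bit \<Rightarrow> bit \<Rightarrow> bit \<Rightarrow> bit ^ 4 \<Rightarrow> bit" where
  "quad p q r a = p * (a $ 2 * a $ 3) + q * (a $ 3 * a $ 4) + r * (a $ 2 * a $ 4)"

text \<open>A cubic polynomial would not satisfy this, which is why it matters that \<open>quad\<close> is quadratic.\<close>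

lemma quad_odd_sum:
  "quad p q r (a + b + d) = quad p q r a + quad p q r b + quad p q r d
     + (quad p q r (a + b) + quad p q r (b + d) + quad p q r (a + d))"
proof -
  have bil: "(x + y + z) * (x' + y' + z') = x * x' + y * y' + z * z'
      + ((x + y) * (x' + y') + (y + z) * (y' + z') + (x + z) * (x' + z'))" for x y z x' y' z' :: bit
    by (cases x; cases y; cases z; cases x'; cases y'; cases z'; simp)
  show ?thesis
    unfolding quad_def vector_add_component bil
    by (simp add: distrib_left add_ac del: add_bit_eq_xor mult_bit_eq_and)
qed

lemma cocycle_transvection_quad:
  assumes "i \<noteq> 1" "j \<noteq> 1" "i \<noteq> j"
  shows "\<exists>p q r. \<forall>a b. cocycle (transvection c i j a) (transvection c i j b) =
    cocycle a b + (quad p q r a + quad p q r b + quad p q r (a + b))"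
proof -
  let ?R = "\<lambda>c i j p q r a b. cocycle (transvection c i j a) (transvection c i j b) =
    cocycle a b + (quad p q r a + quad p q r b + quad p q r (a + b))"
  have R: "?R 1 2 3 1 1 0 a b" "?R 1 2 4 0 1 1 a b" "?R 1 3 2 1 0 1 a b"
    "?R 1 3 4 0 1 0 a b" "?R 1 4 2 0 0 1 a b" "?R 1 4 3 0 1 0 a b" for a b
    unfolding cocycle_def quad_def vector_add_component transvection_nth
    by (cases "a $ 2"; cases "a $ 3"; cases "a $ 4"; cases "b $ 2"; cases "b $ 3"; cases "b $ 4"; simp)+
  show ?thesis
  proof (cases c)
    case zero
    have "transvection 0 i j a = a" for a by (simp add: vec_eq_iff)
    then show ?thesis unfolding zero by (intro exI[of _ 0]) (simp add: quad_def)
  next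
    case one
    consider "i = 2" "j = 3" | "i = 2" "j = 4" | "i = 3" "j = 2"
      | "i = 3" "j = 4" | "i = 4" "j = 2" | "i = 4" "j = 3"
      using assms exhaust_4[of i] exhaust_4[of j] by auto
    then show ?thesis unfolding one by cases (use R in blast)+
  qed
qed

lemma cocycle_transvection:
  assumes ij: "i \<noteq> 1" "i \<noteq> j"
  shows "\<exists>s. \<forall>a\<in>affine_slice. \<forall>b\<in>affine_slice. \<forall>d\<in>affine_slice.
    s (a + b + d) + cocycle (a + b) (b + d) =
    s a + s b + s d + cocycle (transvection c i j (a + b)) (transvection c i j (b + d))"
proof (cases "j = 1")
  case True
  have "transvection c i j (a + b) = a + b" if "a \<in> affine_slice" "b \<in> affine_slice" for a b
    using that True by (simp add: vec_eq_iff affine_slice_def)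
  then show ?thesis by (intro exI[of _ "\<lambda>_. 0"]) simp
next
  case False
  then obtain p q r where pqr: "\<And>a b. cocycle (transvection c i j a) (transvection c i j b) =
    cocycle a b + (quad p q r a + quad p q r b + quad p q r (a + b))"
    using cocycle_transvection_quad ij by metis
  have "quad p q r (a + b + d) + cocycle (a + b) (b + d) = quad p q r a + quad p q r b + quad p q r d
    + cocycle (transvection c i j (a + b)) (transvection c i j (b + d))" for a b d
  proof -
    have "a + b + (b + d) = a + d" by (simp add: add.assoc)
    then show ?thesis
      unfolding pqr[of "a + b" "b + d"] quad_odd_sum[of p q r a b d]
      by (simp add: add_ac del: add_bit_eq_xor)
  qed
  then show ?thesis by blast
qed

section \<open>The Cayley algebra in a CD-basis\<close>

locale CD_graded_cayley = cayley_algebra smul mul unit n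
  for smul :: "'f::field \<Rightarrow> 'c::ab_group_add \<Rightarrow> 'c" and mul unit n +
  fixes w :: "7 \<Rightarrow> 'c" and \<Gamma> :: "bit ^ 4 \<Rightarrow> 'c set"
  assumes CD: "CD_basis smul mul unit w"
    and CD_grading: "CD_grading smul (cayley_triple smul mul unit n) unit w \<Gamma>"
begin

abbreviation tri where "tri \<equiv> cayley_triple smul mul unit n"

lemma mul_add: "mul (x + y) z = mul x z + mul y z" "mul x (y + z) = mul x y + mul x z"
  and mul_scale: "mul (smul k x) y = smul k (mul x y)" "mul x (smul k y) = smul k (mul x y)"
  using linear_mul_left linear_mul_right by (simp_all add: Vector_Spaces.linear_iff)

lemma mul_minus: "mul (- x) y = - mul x y" "mul x (- y) = - mul x y"
  using mul_scale(1)[of "-1" x y] mul_scale(2)[of x "-1" y] by (simp_all add: scale_minus_left)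

lemma polar_add: "polar n (x + y) z = polar n x z + polar n y z"
  and polar_scale: "polar n (smul k x) z = k * polar n x z"
  using linear_polar by (simp_all add: Vector_Spaces.linear_iff)

lemma polar_commute: "polar n x y = polar n y x"
  by (simp add: polar_def add.commute algebra_simps)

lemma polar_add_right: "polar n z (x + y) = polar n z x + polar n z y"
  by (simp add: polar_commute[of z] polar_add)

lemma polar_minus: "polar n (- x) z = - polar n x z"
  using polar_scale[of "-1" x z] by (simp add: scale_minus_left)

lemma polar_diff: "polar n (x - y) z = polar n x z - polar n y z"
  using polar_add[of x "- y" z] by (simp add: polar_minus)

lemma independent_CD: "independent (insert unit (range w))"
  and span_CD: "span (insert unit (range w)) = UNIV"
  and inj_w: "inj w" and unit_notin: "unit \<notin> range w"
  using CD by (auto simp: CD_basis_def)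

lemma norm_add: "n (x + y) = n x + n y + polar n x y"
  by (simp add: polar_def)

lemma unit_nonzero: "unit \<noteq> 0"
  using independent_CD dependent_zero by blast

lemma norm_unit: "n unit = 1"
proof (rule ccontr)
  assume "n unit \<noteq> 1"
  moreover have "n x = n x * n unit" for x
    using norm_mul[of x unit] by (simp add: mul_unit_right)
  ultimately have "n x = 0" for x by (metis mult_cancel_left1 mult.comm_neutral)
  then have "polar n unit y = 0" for y by (simp add: polar_def)
  then show False using nondegenerate unit_nonzero by blast
qed

lemma polar_mul_left: "polar n (mul x y) (mul x z) = n x * polar n y z"
  by (simp add: polar_def norm_mul algebra_simps flip: mul_add)

lemma polar_mul_exchange:
  "polar n (mul x y) (mul u z) + polar n (mul u y) (mul x z) = polar n x u * polar n y z"
proof -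
  have "polar n (mul (x + u) y) (mul (x + u) z) = n (x + u) * polar n y z"
    by (rule polar_mul_left)
  then show ?thesis
    by (simp add: mul_add polar_add polar_add_right polar_mul_left norm_add polar_commute[of u x] algebra_simps)
qed

text \<open>Expanding \<open>n(x, x z) + n(x\<^sup>2, z)\<close> in two ways gives the quadratic equation
  \<open>x\<^sup>2 - n(x, 1) x + n(x) 1 = 0\<close>.\<close>

lemma square: "mul x x = smul (polar n x unit) x - smul (n x) unit"
proof -
  let ?d = "mul x x - smul (polar n x unit) x + smul (n x) unit"
  have "polar n ?d z = 0" for z
  proof -
    have "polar n (mul x x) z + polar n x (mul x z) = polar n x unit * polar n x z"
      using polar_mul_exchange[of x x unit z] by (simp add: mul_unit_left)
    moreover have "polar n x (mul x z) = n x * polar n unit z"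
      using polar_mul_left[of x unit z] by (simp add: mul_unit_right)
    ultimately show ?thesis
      by (simp add: polar_add polar_diff polar_scale algebra_simps)
  qed
  then have "?d = 0" using nondegenerate by blast
  then show ?thesis by (simp add: algebra_simps)
qed

lemma polar_w_unit: "polar n (w i) unit = 0"
proof (rule ccontr)
  let ?t = "polar n (w i) unit"
  assume t: "?t \<noteq> 0"
  have "mul (w i) (w i) = - unit" using CD by (simp add: CD_basis_def)
  with square[of "w i"] have "smul ?t (w i) = smul (n (w i)) unit - unit"
    by (simp add: algebra_simps)
  also have "\<dots> = smul (n (w i) - 1) unit" by (simp add: scale_left_diff_distrib)
  finally have "smul (inverse ?t) (smul ?t (w i)) = smul (inverse ?t) (smul (n (w i) - 1) unit)"
    by simp
  then have "w i = smul (inverse ?t * (n (w i) - 1)) unit" using t by simp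
  then have "w i \<in> span (insert unit (range w) - {w i})"
    using unit_notin by (metis insert_iff insert_Diff_if rangeI singletonD span_base span_scale)
  then show False using independent_CD dependent_def by blast
qed

definition cd :: "bit \<Rightarrow> bit \<Rightarrow> bit \<Rightarrow> 'c" where
  "cd x y z =
     (if x = 0 then if y = 0 then if z = 0 then unit else w 3 else if z = 0 then w 2 else w 5
      else if y = 0 then if z = 0 then w 1 else w 0 else if z = 0 then w 4 else w 6)"

definition elt :: "bit ^ 4 \<Rightarrow> 'c" where
  "elt a = cd (a $ 2) (a $ 3) (a $ 4)"

lemma w_square: "mul (w i) (w i) = - unit"
  using CD by (simp add: CD_basis_def)

lemma w_mul:
  "mul (w i) (w (i + 1)) = w (i + 3)" "mul (w (i + 1)) (w i) = - w (i + 3)"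
  "mul (w (i + 1)) (w (i + 3)) = w i" "mul (w (i + 3)) (w (i + 1)) = - w i"
  "mul (w (i + 3)) (w i) = w (i + 1)" "mul (w i) (w (i + 3)) = - w (i + 1)"
  using CD by (simp_all add: CD_basis_def)

lemma numerals_mod_7: "(7 :: 7) = 0" "(8 :: 7) = 1" "(9 :: 7) = 2"
  by simp_all

lemmas w_table = w_mul[of 0, simplified] w_mul[of 1, simplified] w_mul[of 2, simplified]
  w_mul[of 3, simplified] w_mul[of 4, simplified, unfolded numerals_mod_7] w_mul[of 5, simplified, unfolded numerals_mod_7]
  w_mul[of 6, simplified, unfolded numerals_mod_7]

lemma mul_elt: "mul (elt a) (elt b) = sgn_bit (cocycle a b) (elt (a + b))"
  unfolding elt_def cocycle_def vector_add_component
  by (cases "a $ 2"; cases "a $ 3"; cases "a $ 4"; cases "b $ 2"; cases "b $ 3"; cases "b $ 4";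
      simp add: cd_def w_table w_square mul_unit_left mul_unit_right)

abbreviation B where "B \<equiv> insert unit (range w)"

lemma conj_elt:
  "cayley_conj smul unit n (elt a) = sgn_bit (of_bool (a $ 2 \<noteq> 0 \<or> a $ 3 \<noteq> 0 \<or> a $ 4 \<noteq> 0)) (elt a)"
proof -
  have "unit + unit = smul (1 + 1) unit" by (simp only: scale_left_distrib scale_one)
  then have "n (unit + unit) = (1 + 1)\<^sup>2" by (simp only: norm_scale norm_unit mult_1_right)
  then have "polar n unit unit = 1 + 1" by (simp add: polar_def norm_unit power2_eq_square)
  then have "cayley_conj smul unit n unit = unit"
    unfolding cayley_conj_def by (simp only: scale_left_distrib scale_one) simp
  moreover have "cayley_conj smul unit n (w i) = - w i" for i
    by (simp add: cayley_conj_def polar_w_unit)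
  ultimately show ?thesis
    by (cases "a $ 2"; cases "a $ 3"; cases "a $ 4"; simp add: elt_def cd_def)
qed

lemma mul_sgn_bit: "mul (sgn_bit b x) y = sgn_bit b (mul x y)" "mul x (sgn_bit b y) = sgn_bit b (mul x y)"
  by (cases b; simp add: mul_minus)+

lemma tri_elt:
  "tri (elt a) (elt b) (elt c) = sgn_bit (cocycle (a + b) (b + c)) (elt (a + b + c))"
  unfolding cayley_triple_def conj_elt mul_sgn_bit mul_elt cocycle_triple[symmetric] sgn_bit_add
  by (cases "cocycle a b"; cases "cocycle (a + b) c"; simp)

lemma conj_add: "cayley_conj smul unit n (x + y) = cayley_conj smul unit n x + cayley_conj smul unit n y"
  and conj_scale: "cayley_conj smul unit n (smul k x) = smul k (cayley_conj smul unit n x)"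
  by (simp_all add: cayley_conj_def polar_add polar_scale scale_left_distrib scale_right_diff_distrib algebra_simps)

lemma tri_add:
  "tri (x + x') y z = tri x y z + tri x' y z" "tri x (y + y') z = tri x y z + tri x y' z"
  "tri x y (z + z') = tri x y z + tri x y z'"
  by (simp_all add: cayley_triple_def conj_add mul_add)

lemma tri_scale:
  "tri (smul k x) y z = smul k (tri x y z)" "tri x (smul k y) z = smul k (tri x y z)"
  "tri x y (smul k z) = smul k (tri x y z)"
  by (simp_all add: cayley_triple_def conj_scale mul_scale)

lemma tri_zero: "tri 0 y z = 0" "tri x 0 z = 0" "tri x y 0 = 0"
  using tri_scale(1)[of 0 0 y z] tri_scale(2)[of x 0 0 z] tri_scale(3)[of x y 0 0] by simp_all

lemma UNIV_7: "UNIV = {0, 1, 2, 3, 4, 5, 6 :: 7}"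
  by (rule sym, rule card_seteq) simp_all

lemma elt_slice: "elt ` affine_slice = B"
proof -
  have "range w = {w 0, w 1, w 2, w 3, w 4, w 5, w 6}"
    unfolding UNIV_7 by simp
  then have "B = {cd 0 0 0, cd 1 0 1, cd 1 0 0, cd 0 1 0, cd 0 0 1, cd 1 1 0, cd 0 1 1, cd 1 1 1}"
    by (simp add: cd_def)
  also have "\<dots> \<subseteq> elt ` affine_slice"
  proof -
    have "cd x y z \<in> elt ` affine_slice" for x y z
      by (rule image_eqI[of _ _ "vector [1, x, y, z]"]) (simp_all add: elt_def affine_slice_def)
    then show ?thesis by blast
  qed
  finally show ?thesis by (auto simp: elt_def cd_def)
qed

lemma inj_elt: "inj_on elt affine_slice"
proof (rule inj_onI)
  fix a b assume ab: "a \<in> affine_slice" "b \<in> affine_slice" and eq: "elt a = elt b"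
  have "unit \<noteq> w i" "w i \<noteq> unit" for i using unit_notin by auto
  moreover have "w i = w j \<longleftrightarrow> i = j" for i j using inj_w by (simp add: inj_eq)
  ultimately have "a $ 2 = b $ 2 \<and> a $ 3 = b $ 3 \<and> a $ 4 = b $ 4"
    using eq unfolding elt_def
    by (cases "a $ 2"; cases "a $ 3"; cases "a $ 4"; cases "b $ 2"; cases "b $ 3"; cases "b $ 4";
        simp add: cd_def)
  then show "a = b" using ab by (simp add: vec4_eq_iff affine_slice_def)
qed

lemma elt_nonzero: "elt a \<noteq> 0"
proof -
  have "elt a \<in> B" by (simp add: elt_def cd_def)
  then show ?thesis using independent_CD dependent_zero by metis
qed

subsection \<open>Homogeneous components\<close>

lemma grading: "grading smul tri \<Gamma>"
  and components: "components \<Gamma> = (\<lambda>v. span {v}) ` B"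
  using CD_grading by (auto simp: CD_grading_def)

lemma subspace_component: "subspace (\<Gamma> a)"
  using grading by (simp add: grading_def direct_sum_decomposition_def)

lemma component_tri:
  "\<lbrakk>x \<in> \<Gamma> a; y \<in> \<Gamma> b; z \<in> \<Gamma> c\<rbrakk> \<Longrightarrow> tri x y z \<in> \<Gamma> (a + b + c)"
  using grading by (simp add: grading_def)

lemma degree_unique:
  assumes "x \<in> \<Gamma> a" "x \<in> \<Gamma> b" "x \<noteq> 0"
  shows "a = b"
proof -
  define P where "P f \<longleftrightarrow> (\<forall>a. f a \<in> \<Gamma> a) \<and> finite {a. f a \<noteq> 0} \<and> x = (\<Sum>a | f a \<noteq> 0. f a)" for f
  have ex1: "\<exists>!f. P f"
    using grading by (simp add: grading_def direct_sum_decomposition_def P_def)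
  let ?f = "\<lambda>a c. if c = a then x else 0"
  have single: "P (?f a)" if "x \<in> \<Gamma> a" for a
  proof -
    have f: "{c. ?f a c \<noteq> 0} = {a}" using assms(3) by auto
    have "?f a c \<in> \<Gamma> c" for c using that subspace_0[OF subspace_component] by simp
    then show ?thesis unfolding P_def f by simp
  qed
  obtain f where "\<And>g. P g \<Longrightarrow> g = f" using ex1 by blast
  then have "?f a = ?f b" using single assms by metis
  then have "?f a a = ?f b a" by (rule fun_cong)
  then show ?thesis using assms(3) by (simp split: if_splits)
qed

lemma elt_in_component:
  assumes "a \<in> affine_slice" shows "elt a \<in> \<Gamma> a"
proof -
  let ?v = "\<lambda>x y z. vector [1, x, y, z] :: bit ^ 4"
  have base: "unit \<in> \<Gamma> (?v 0 0 0)" "w 1 \<in> \<Gamma> (?v 1 0 0)" "w 2 \<in> \<Gamma> (?v 0 1 0)" "w 3 \<in> \<Gamma> (?v 0 0 1)"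
    using CD_grading by (simp_all add: CD_grading_def)
  have conj: "cayley_conj smul unit n unit = unit"
    using conj_elt[of 0] by (simp add: elt_def cd_def)
  have sum: "?v x y z + ?v 0 0 0 + ?v x' y' z' = ?v (x + x') (y + y') (z + z')" for x y z x' y' z'
    by (simp add: vec4_eq_iff)
  have prod: "mul p q \<in> \<Gamma> (?v (x + x') (y + y') (z + z'))"
    if "p \<in> \<Gamma> (?v x y z)" "q \<in> \<Gamma> (?v x' y' z')" for p q x y z x' y' z'
    using component_tri[OF that(1) base(1) that(2)]
    by (simp add: cayley_triple_def conj mul_unit_right sum del: add_bit_eq_xor)
  have 4: "w 4 \<in> \<Gamma> (?v 1 1 0)" using prod[OF base(2,3)] by (simp add: w_table)
  have 5: "w 5 \<in> \<Gamma> (?v 0 1 1)" using prod[OF base(3,4)] by (simp add: w_table)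
  have 6: "w 6 \<in> \<Gamma> (?v 1 1 1)" using prod[OF base(4) 4] by (simp add: w_table)
  have 0: "w 0 \<in> \<Gamma> (?v 1 0 1)" using prod[OF 4 5] by (simp add: w_table)
  have "a = ?v (a $ 2) (a $ 3) (a $ 4)" using assms by (simp add: vec4_eq_iff affine_slice_def)
  moreover have "cd x y z \<in> \<Gamma> (?v x y z)" for x y z
    using base 0 4 5 6 by (cases x; cases y; cases z; simp add: cd_def)
  ultimately show ?thesis unfolding elt_def by metis
qed

lemma component_slice:
  assumes "a \<in> affine_slice" shows "\<Gamma> a = span {elt a}"
proof -
  have "\<Gamma> a \<in> components \<Gamma>"
    using elt_in_component[OF assms] elt_nonzero[of a] by (auto simp: components_def supp_def)
  then obtain v where v: "v \<in> B" "\<Gamma> a = span {v}" unfolding components by blast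
  then obtain k where k: "elt a = smul k v"
    using elt_in_component[OF assms] by (auto simp: span_singleton)
  then have "k \<noteq> 0" using elt_nonzero[of a] by auto
  then have "v = smul (inverse k) (elt a)" by (simp add: k)
  then have "v \<in> span {elt a}" by (metis span_base span_scale singletonI)
  then have "span {v} \<subseteq> span {elt a}" by (simp add: span_minimal)
  moreover have "span {elt a} \<subseteq> span {v}"
    using v elt_in_component[OF assms] by (simp add: span_minimal)
  ultimately show ?thesis using v by simp
qed

lemma supp_eq: "supp \<Gamma> = affine_slice"
proof
  show "affine_slice \<subseteq> supp \<Gamma>"
    using elt_in_component elt_nonzero by (fastforce simp: supp_def)
  show "supp \<Gamma> \<subseteq> affine_slice"
  proof
    fix b assume "b \<in> supp \<Gamma>"
    then have "\<Gamma> b \<in> components \<Gamma>" by (simp add: components_def)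
    then obtain a where "a \<in> affine_slice" "\<Gamma> b = span {elt a}"
      unfolding components elt_slice[symmetric] by blast
    then have "elt a \<in> \<Gamma> b" by (simp add: span_base)
    then show "b \<in> affine_slice"
      using \<open>a \<in> affine_slice\<close> elt_in_component degree_unique elt_nonzero by blast
  qed
qed

lemma component_inj:
  assumes "a \<in> affine_slice" "\<Gamma> a = \<Gamma> b" shows "a = b"
  using assms elt_in_component[OF assms(1)] degree_unique elt_nonzero by metis

subsection \<open>Action of automorphisms on the support\<close>

definition acts where
  "acts \<phi> g \<longleftrightarrow> \<phi> \<in> triple_automorphisms smul tri \<and> g \<in> GL_slice \<and>
     (\<forall>a\<in>affine_slice. \<phi> ` \<Gamma> a = \<Gamma> (g a))"

lemma GL_slice_mem: "\<lbrakk>g \<in> GL_slice; a \<in> affine_slice\<rbrakk> \<Longrightarrow> g a \<in> affine_slice"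
  by (simp add: GL_slice_iff affine_slice_def)

lemma acts_unique: "\<lbrakk>acts \<phi> g; acts \<phi> h\<rbrakk> \<Longrightarrow> g = h"
  unfolding acts_def by (metis GL_slice_eqI GL_slice_mem component_inj)

lemma triple_automorphism_comp:
  "\<lbrakk>\<phi> \<in> triple_automorphisms smul tri; \<psi> \<in> triple_automorphisms smul tri\<rbrakk>
    \<Longrightarrow> \<phi> \<circ> \<psi> \<in> triple_automorphisms smul tri"
  by (auto simp: triple_automorphisms_def bij_comp Vector_Spaces.linear_iff)

lemma triple_automorphism_inverse:
  assumes "\<phi> \<in> triple_automorphisms smul tri"
  shows "inv_into UNIV \<phi> \<in> triple_automorphisms smul tri"
proof -
  let ?h = "inv_into UNIV \<phi>"
  have \<phi>: "\<And>x y. \<phi> (x + y) = \<phi> x + \<phi> y" "\<And>k x. \<phi> (smul k x) = smul k (\<phi> x)" "bij \<phi>"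
      "\<And>x y z. \<phi> (tri x y z) = tri (\<phi> x) (\<phi> y) (\<phi> z)"
    using assms by (auto simp: triple_automorphisms_def Vector_Spaces.linear_iff)
  have h: "?h (\<phi> x) = x" "\<phi> (?h x) = x" for x
    using \<phi>(3) by (simp_all add: bij_is_inj bij_is_surj surj_f_inv_f)
  have "?h (x + y) = ?h x + ?h y" for x y using h \<phi>(1) by metis
  moreover have "?h (smul k x) = smul k (?h x)" for k x using h \<phi>(2) by metis
  moreover have "?h (tri x y z) = tri (?h x) (?h y) (?h z)" for x y z using h \<phi>(4) by metis
  ultimately show ?thesis
    using \<phi>(3) by (simp add: triple_automorphisms_def Vector_Spaces.linear_iff bij_imp_bij_inv vector_space_axioms)
qed

lemma acts_id: "acts id id"
  by (simp add: acts_def GL_slice_id triple_automorphisms_def linear_id)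

lemma acts_comp: "\<lbrakk>acts \<phi> g; acts \<psi> h\<rbrakk> \<Longrightarrow> acts (\<phi> \<circ> \<psi>) (g \<circ> h)"
  unfolding acts_def image_comp[symmetric]
  by (simp add: triple_automorphism_comp GL_slice_comp GL_slice_mem del: image_comp)

lemma acts_inverse:
  assumes "acts \<phi> g"
  shows "\<exists>h. acts (inv_into UNIV \<phi>) h"
proof -
  obtain h where h: "h \<in> GL_slice" "g \<circ> h = id"
    using assms GL_slice_inverse unfolding acts_def by metis
  have "inj \<phi>" using assms by (simp add: acts_def triple_automorphisms_def bij_is_inj)
  have "inv_into UNIV \<phi> ` \<Gamma> a = \<Gamma> (h a)" if "a \<in> affine_slice" for a
  proof -
    have "\<Gamma> a = \<phi> ` \<Gamma> (h a)"
      using assms h that by (simp add: acts_def GL_slice_mem fun_eq_iff)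
    then show ?thesis using \<open>inj \<phi>\<close> by (simp add: image_inv_f_f)
  qed
  then show ?thesis
    using assms h triple_automorphism_inverse unfolding acts_def by blast
qed

lemma grading_automorphisms_iff: "\<phi> \<in> grading_automorphisms smul tri \<Gamma> \<longleftrightarrow> (\<exists>g. acts \<phi> g)"
proof
  assume \<phi>: "\<phi> \<in> grading_automorphisms smul tri \<Gamma>"
  then have aut: "\<phi> \<in> triple_automorphisms smul tri"
    and comp: "bij_betw (image \<phi>) (components \<Gamma>) (components \<Gamma>)"
    by (auto simp: grading_automorphisms_def)
  have \<phi>_tri: "\<phi> (tri x y z) = tri (\<phi> x) (\<phi> y) (\<phi> z)" for x y z
    using aut by (simp add: triple_automorphisms_def)
  have inj: "inj \<phi>" using aut by (simp add: triple_automorphisms_def bij_is_inj)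
  have \<phi>0: "\<phi> 0 = 0"
    using aut module_hom.zero[of smul smul \<phi>]
    by (simp add: triple_automorphisms_def linear_iff_module_hom)
  have "\<exists>b\<in>affine_slice. \<phi> ` \<Gamma> a = \<Gamma> b" if "a \<in> affine_slice" for a
    using bij_betwE[OF comp] that by (simp add: components_def supp_eq image_iff)
  then obtain p where p: "\<And>a. a \<in> affine_slice \<Longrightarrow> p a \<in> affine_slice"
    "\<And>a. a \<in> affine_slice \<Longrightarrow> \<phi> ` \<Gamma> a = \<Gamma> (p a)" by metis
  have "\<exists>g\<in>GL_slice. \<forall>a\<in>affine_slice. g a = p a"
  proof (rule slice_permutation_extends[OF p(1)])
    fix a b c assume abc: "a \<in> affine_slice" "b \<in> affine_slice" "c \<in> affine_slice"
    let ?x = "tri (elt a) (elt b) (elt c)"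
    have mem: "\<phi> x \<in> \<Gamma> (p a)" if "a \<in> affine_slice" "x \<in> \<Gamma> a" for a x using p(2) that by blast
    have "?x \<in> \<Gamma> (a + b + c)" using abc by (simp add: component_tri elt_in_component)
    then have "\<phi> ?x \<in> \<Gamma> (p (a + b + c))" using abc affine_slice_odd_sum mem by blast
    moreover have "\<phi> ?x \<in> \<Gamma> (p a + p b + p c)"
      unfolding \<phi>_tri using abc by (intro component_tri mem elt_in_component)
    moreover have "?x \<noteq> 0"
      unfolding tri_elt using elt_nonzero by (simp add: sgn_bit_def)
    then have "\<phi> ?x \<noteq> 0" using inj \<phi>0 by (metis injD)
    ultimately show "p (a + b + c) = p a + p b + p c" by (rule degree_unique)
  next
    show "inj_on p affine_slice"
      by (metis (no_types, lifting) inj inj_onI p(2) inj_image_eq_iff component_inj)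
  qed
  then show "\<exists>g. acts \<phi> g" using aut p(2) unfolding acts_def by metis
next
  assume "\<exists>g. acts \<phi> g"
  then obtain g where g: "acts \<phi> g" ..
  then have "g \<in> GL_slice" and aut: "\<phi> \<in> triple_automorphisms smul tri" by (auto simp: acts_def)
  obtain h where h: "h \<in> GL_slice" "g \<circ> h = id" using \<open>g \<in> GL_slice\<close> GL_slice_inverse by metis
  have "inj_on (image \<phi>) (components \<Gamma>)"
    using aut by (auto intro!: inj_onI simp: triple_automorphisms_def inj_image_eq_iff[OF bij_is_inj])
  moreover have "image \<phi> ` \<Gamma> ` affine_slice = \<Gamma> ` affine_slice"
  proof
    show "image \<phi> ` \<Gamma> ` affine_slice \<subseteq> \<Gamma> ` affine_slice"
      using g by (auto simp: acts_def GL_slice_mem)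
    show "\<Gamma> ` affine_slice \<subseteq> image \<phi> ` \<Gamma> ` affine_slice"
    proof
      fix X assume "X \<in> \<Gamma> ` affine_slice"
      then obtain a where a: "a \<in> affine_slice" "X = \<Gamma> a" by blast
      then have "X = \<phi> ` \<Gamma> (h a)" using g h by (simp add: acts_def GL_slice_mem fun_eq_iff)
      then show "X \<in> image \<phi> ` \<Gamma> ` affine_slice" by (simp only: imageI GL_slice_mem[OF h(1) a(1)])
    qed
  qed
  ultimately show "\<phi> \<in> grading_automorphisms smul tri \<Gamma>"
    using aut by (simp add: grading_automorphisms_def bij_betw_def components_def supp_eq)
qed

lemma grading_stabilizer_iff: "\<phi> \<in> grading_stabilizer smul tri \<Gamma> \<longleftrightarrow> acts \<phi> id"
  by (auto simp: grading_stabilizer_def acts_def GL_slice_id components_def supp_eq)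

lemma tri_hom_on_basis:
  assumes lin: "Vector_Spaces.linear smul smul \<phi>"
    and B: "\<And>x y z. \<lbrakk>x \<in> B; y \<in> B; z \<in> B\<rbrakk> \<Longrightarrow> \<phi> (tri x y z) = tri (\<phi> x) (\<phi> y) (\<phi> z)"
  shows "\<phi> (tri x y z) = tri (\<phi> x) (\<phi> y) (\<phi> z)"
proof -
  have \<phi>: "\<phi> (x + y) = \<phi> x + \<phi> y" "\<phi> (smul k x) = smul k (\<phi> x)" for x y k
    using lin by (simp_all add: Vector_Spaces.linear_iff)
  have \<phi>0: "\<phi> 0 = 0" using \<phi>(2)[of 0 0] by simp
  have extend: "P x" if "\<And>x. x \<in> B \<Longrightarrow> P x" "subspace (Collect P)" for P x
    using span_minimal[of B "Collect P"] that span_CD by blast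
  have 1: "\<phi> (tri x y z) = tri (\<phi> x) (\<phi> y) (\<phi> z)" if "y \<in> B" "z \<in> B" for x y z
    by (rule extend[where P = "\<lambda>x. \<phi> (tri x y z) = tri (\<phi> x) (\<phi> y) (\<phi> z)"])
      (use that B in \<open>auto simp: subspace_def tri_add tri_scale tri_zero \<phi> \<phi>0\<close>)
  have 2: "\<phi> (tri x y z) = tri (\<phi> x) (\<phi> y) (\<phi> z)" if "z \<in> B" for x y z
    by (rule extend[where P = "\<lambda>y. \<phi> (tri x y z) = tri (\<phi> x) (\<phi> y) (\<phi> z)"])
      (use that 1 in \<open>auto simp: subspace_def tri_add tri_scale tri_zero \<phi> \<phi>0\<close>)
  show ?thesis
    by (rule extend[where P = "\<lambda>z. \<phi> (tri x y z) = tri (\<phi> x) (\<phi> y) (\<phi> z)"])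
      (use 2 in \<open>auto simp: subspace_def tri_add tri_scale tri_zero \<phi> \<phi>0\<close>)
qed

lemma span_sgn_bit: "span {sgn_bit b x} = span {x}"
proof (cases b)
  case one
  have "span {- x} \<subseteq> span {x}" "span {x} \<subseteq> span {- x}"
    using span_neg[of x "{x}"] span_neg[of "- x" "{- x}"] by (simp_all add: span_minimal span_base)
  then show ?thesis using one by simp
qed simp

lemma acts_monomial:
  assumes g: "g \<in> GL_slice"
    and s: "\<And>a b d. \<lbrakk>a \<in> affine_slice; b \<in> affine_slice; d \<in> affine_slice\<rbrakk> \<Longrightarrow>
      s (a + b + d) + cocycle (a + b) (b + d) = s a + s b + s d + cocycle (g (a + b)) (g (b + d))"
  shows "\<exists>\<phi>. acts \<phi> g"
proof -
  interpret fd: finite_dimensional_vector_space smul B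
    by unfold_locales (simp_all add: independent_CD span_CD)
  interpret vp: vector_space_pair smul smul ..
  have g_add: "g (x + y) = g x + g y" for x y using g by (simp add: GL_slice_iff)
  obtain h where h: "h \<in> GL_slice" "g \<circ> h = id" using g GL_slice_inverse by metis
  define f where "f x = (let a = inv_into affine_slice elt x in sgn_bit (s a) (elt (g a)))" for x
  obtain \<phi> where lin: "Vector_Spaces.linear smul smul \<phi>" and "\<forall>x\<in>B. \<phi> x = f x"
    using vp.linear_independent_extend[OF independent_CD, of f] by blast
  then have \<phi>: "\<phi> (elt a) = sgn_bit (s a) (elt (g a))" if "a \<in> affine_slice" for a
    using that inj_elt unfolding elt_slice[symmetric] by (simp add: f_def)
  have image: "\<phi> ` \<Gamma> a = \<Gamma> (g a)" if "a \<in> affine_slice" for a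
    using that g vp.linear_span_image[OF lin, of "{elt a}"]
    by (simp add: component_slice GL_slice_mem \<phi> span_sgn_bit)
  have "B \<subseteq> range \<phi>"
  proof
    fix x assume "x \<in> B"
    then obtain a where a: "a \<in> affine_slice" "x = elt a" unfolding elt_slice[symmetric] by blast
    then have "x \<in> \<phi> ` \<Gamma> (h a)"
      using image[of "h a"] h by (simp add: GL_slice_mem elt_in_component fun_eq_iff)
    then show "x \<in> range \<phi>" by blast
  qed
  then have "surj \<phi>"
    using span_minimal[of B "range \<phi>"] vp.linear_subspace_image[OF lin subspace_UNIV] span_CD by auto
  then have "bij \<phi>" using fd.linear_surj_imp_inj[OF lin] by (simp add: bij_def)
  have sgn: "tri (sgn_bit p x) (sgn_bit q y) (sgn_bit r z) = sgn_bit (p + q + r) (tri x y z)" for p q r x y z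
    using tri_scale(1)[of "-1" x] tri_scale(2)[of _ "-1" y] tri_scale(3)[of _ _ "-1" z]
    by (cases p; cases q; cases r; simp add: scale_minus_left)
  have "\<phi> (tri x y z) = tri (\<phi> x) (\<phi> y) (\<phi> z)" for x y z
  proof (rule tri_hom_on_basis[OF lin])
    fix x y z assume "x \<in> B" "y \<in> B" "z \<in> B"
    then obtain a b d where abd: "a \<in> affine_slice" "b \<in> affine_slice" "d \<in> affine_slice"
      and xyz: "x = elt a" "y = elt b" "z = elt d"
      unfolding elt_slice[symmetric] by blast
    have neg: "\<phi> (sgn_bit p x) = sgn_bit p (\<phi> x)" for p x
      using vp.linear_neg[OF lin] by (cases p) simp_all
    have "\<phi> (tri x y z) = sgn_bit (s (a + b + d) + cocycle (a + b) (b + d)) (elt (g (a + b + d)))"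
      using abd by (simp add: xyz tri_elt neg \<phi> affine_slice_odd_sum sgn_bit_add add.commute[of "s _"] del: add_bit_eq_xor)
    also have "\<dots> = tri (\<phi> x) (\<phi> y) (\<phi> z)"
      using abd by (simp add: xyz \<phi> sgn tri_elt s g_add sgn_bit_add del: add_bit_eq_xor)
    finally show "\<phi> (tri x y z) = tri (\<phi> x) (\<phi> y) (\<phi> z)" .
  qed
  then have "acts \<phi> g"
    using g lin \<open>bij \<phi>\<close> image by (simp add: acts_def triple_automorphisms_def)
  then show ?thesis by blast
qed

lemma ex_acts:
  assumes "g \<in> GL_slice" shows "\<exists>\<phi>. acts \<phi> g"
  using assms
proof (rule GL_slice_transvection_induct)
  show "\<exists>\<phi>. acts \<phi> id" using acts_id by blast
next
  fix c i j h assume ij: "i \<noteq> 1" "i \<noteq> j" and "\<exists>\<phi>. acts \<phi> (transvection c i j \<circ> h)"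
  then obtain \<phi> where "acts \<phi> (transvection c i j \<circ> h)" by blast
  moreover obtain \<psi> where "acts \<psi> (transvection c i j)"
    using acts_monomial[OF transvection_GL_slice[OF ij]] cocycle_transvection[OF ij] by metis
  ultimately have "acts (\<psi> \<circ> \<phi>) (transvection c i j \<circ> (transvection c i j \<circ> h))"
    using acts_comp by blast
  moreover have "transvection c i j \<circ> (transvection c i j \<circ> h) = h"
    using ij by (simp add: fun_eq_iff transvection_involution)
  ultimately show "\<exists>\<phi>. acts \<phi> h" by auto
qed

abbreviation "Aut_group \<equiv> comp_group (grading_automorphisms smul tri \<Gamma>)"

lemma group_Aut: "group Aut_group"
proof (rule group_comp_group)
  fix \<phi> assume "\<phi> \<in> grading_automorphisms smul tri \<Gamma>"
  then obtain g where g: "acts \<phi> g" by (auto simp: grading_automorphisms_iff)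
  then have "inv_into UNIV \<phi> \<circ> \<phi> = id"
    by (simp add: acts_def triple_automorphisms_def bij_is_inj)
  then show "\<exists>\<psi>\<in>grading_automorphisms smul tri \<Gamma>. \<psi> \<circ> \<phi> = id"
    using acts_inverse[OF g] grading_automorphisms_iff by blast
qed (auto simp: grading_automorphisms_iff intro: acts_id acts_comp)

definition degree_map where "degree_map \<phi> = (THE g. acts \<phi> g)"

lemma degree_map_eq: "acts \<phi> g \<Longrightarrow> degree_map \<phi> = g"
  unfolding degree_map_def using acts_unique by blast

lemma degree_map_GL_slice:
  "\<phi> \<in> grading_automorphisms smul tri \<Gamma> \<Longrightarrow> degree_map \<phi> \<in> GL_slice"
  using degree_map_eq acts_def grading_automorphisms_iff by metis

lemma degree_map_group_hom: "group_hom Aut_group (comp_group GL_slice) degree_map"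
proof (intro group_hom.intro group_hom_axioms.intro group_Aut group_GL_slice homI)
  fix \<phi> assume "\<phi> \<in> carrier Aut_group"
  then show "degree_map \<phi> \<in> carrier (comp_group GL_slice)"
    by (simp add: comp_group_def degree_map_GL_slice)
next
  fix \<phi> \<psi> assume "\<phi> \<in> carrier Aut_group" "\<psi> \<in> carrier Aut_group"
  then obtain g h where "acts \<phi> g" "acts \<psi> h"
    by (auto simp: comp_group_def grading_automorphisms_iff)
  then show "degree_map (\<phi> \<otimes>\<^bsub>Aut_group\<^esub> \<psi>) = degree_map \<phi> \<otimes>\<^bsub>comp_group GL_slice\<^esub> degree_map \<psi>"
    using acts_comp[of \<phi> g \<psi> h] by (simp add: comp_group_def degree_map_eq)
qed

lemma kernel_degree_map:
  "kernel Aut_group (comp_group GL_slice) degree_map = grading_stabilizer smul tri \<Gamma>"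
  by (auto simp: kernel_def comp_group_def grading_automorphisms_iff grading_stabilizer_iff degree_map_eq)

lemma degree_map_surj: "degree_map ` carrier Aut_group = carrier (comp_group GL_slice)"
proof
  show "degree_map ` carrier Aut_group \<subseteq> carrier (comp_group GL_slice)"
    by (auto simp: comp_group_def degree_map_GL_slice)
  show "carrier (comp_group GL_slice) \<subseteq> degree_map ` carrier Aut_group"
  proof
    fix g assume "g \<in> carrier (comp_group GL_slice)"
    then obtain \<phi> where "acts \<phi> g" using ex_acts by (auto simp: comp_group_def)
    then show "g \<in> degree_map ` carrier Aut_group"
      by (auto simp: comp_group_def grading_automorphisms_iff degree_map_eq intro!: image_eqI[of _ _ \<phi>])
  qed
qed

subsection \<open>The Weyl group\<close>

lemma weyl_carrier:
  assumes "X \<in> carrier (weyl_group smul tri \<Gamma>)"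
  shows "\<exists>g. X \<noteq> {} \<and> (\<forall>\<phi>\<in>X. acts \<phi> g)"
proof -
  obtain \<psi> g where \<psi>: "acts \<psi> g" and X: "X = grading_stabilizer smul tri \<Gamma> #>\<^bsub>Aut_group\<^esub> \<psi>"
    using assms unfolding weyl_group_def carrier_FactGroup
    by (auto simp: comp_group_def grading_automorphisms_iff)
  have "\<psi> \<in> X"
    using acts_id by (auto simp: X r_coset_def comp_group_def grading_stabilizer_iff intro!: bexI[of _ id])
  moreover have "acts \<phi> g" if "\<phi> \<in> X" for \<phi>
    using that acts_comp[OF _ \<psi>, of _ id]
    by (auto simp: X r_coset_def comp_group_def grading_stabilizer_iff)
  ultimately show ?thesis by blast
qed

lemma extends_weyl_action_iff:
  assumes "X \<noteq> {}" "\<And>\<phi>. \<phi> \<in> X \<Longrightarrow> acts \<phi> g"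
  shows "extends_weyl_action \<Gamma> X h \<longleftrightarrow> h = g"
proof
  assume h: "extends_weyl_action \<Gamma> X h"
  obtain \<phi> where \<phi>: "\<phi> \<in> X" "acts \<phi> g" using assms by blast
  have eq: "\<Gamma> (g a) = \<Gamma> (h a)" if "a \<in> affine_slice" for a
    using h \<phi> that by (simp add: extends_weyl_action_def acts_def supp_eq)
  have "g a = h a" if "a \<in> affine_slice" for a
    using \<phi> that eq[OF that] by (intro component_inj) (auto simp: acts_def GL_slice_mem)
  moreover have "g \<in> GL_slice" using \<phi> by (simp add: acts_def)
  moreover from calculation have "h \<in> GL_slice"
    using h by (auto simp: extends_weyl_action_def GL_slice_def dest: GL_slice_mem)
  ultimately show "h = g" using GL_slice_eqI by metis
next
  assume "h = g"
  then show "extends_weyl_action \<Gamma> X h"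
    using assms by (auto simp: extends_weyl_action_def acts_def supp_eq GL_slice_def)
qed

lemma weyl_embedding_eq:
  assumes "X \<in> carrier (weyl_group smul tri \<Gamma>)"
  shows "weyl_embedding \<Gamma> X = the_elem (degree_map ` X)"
proof -
  obtain g where g: "X \<noteq> {}" "\<And>\<phi>. \<phi> \<in> X \<Longrightarrow> acts \<phi> g" using weyl_carrier[OF assms] by blast
  have "degree_map ` X = {g}" using g degree_map_eq by (auto simp: image_iff)
  moreover have "weyl_embedding \<Gamma> X = g"
    unfolding weyl_embedding_def by (rule the_equality) (simp_all add: extends_weyl_action_iff[OF g])
  ultimately show ?thesis by simp
qed

lemma weyl_embedding_iso: "weyl_embedding \<Gamma> \<in> iso (weyl_group smul tri \<Gamma>) (comp_group GL_slice)"
proof -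
  interpret group_hom Aut_group "comp_group GL_slice" degree_map by (rule degree_map_group_hom)
  have "group (weyl_group smul tri \<Gamma>)"
    unfolding weyl_group_def kernel_degree_map[symmetric]
    by (rule normal.factorgroup_is_group[OF normal_kernel])
  then show ?thesis
    using FactGroup_iso_set[OF degree_map_surj]
    by (intro group.iso_eq[OF _ _ weyl_embedding_eq]) (simp_all add: weyl_group_def kernel_degree_map)
qed

end

theorem mainTheorem16:
  fixes smul :: "'f::alg_closed_field \<Rightarrow> 'c::ab_group_add \<Rightarrow> 'c"
    and mul :: "'c \<Rightarrow> 'c \<Rightarrow> 'c"
    and unit :: 'c
    and n :: "'c \<Rightarrow> 'f"
    and w :: "7 \<Rightarrow> 'c"
    and \<Gamma> :: "bit ^ 4 \<Rightarrow> 'c set"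
  assumes "CHAR('f) \<noteq> 2"
    and "cayley_algebra smul mul unit n"
    and "CD_basis smul mul unit w"
    and "CD_grading smul (cayley_triple smul mul unit n) unit w \<Gamma>"
  shows "(\<forall>X\<in>carrier (weyl_group smul (cayley_triple smul mul unit n) \<Gamma>).
            \<exists>!\<gamma>. extends_weyl_action \<Gamma> X \<gamma>) \<and>
         weyl_embedding \<Gamma>
           \<in> iso (weyl_group smul (cayley_triple smul mul unit n) \<Gamma>) (comp_group GL_slice) \<and>
         slice_to_affine \<in> iso (comp_group GL_slice) (comp_group Aff)"
proof -
  interpret CD_graded_cayley smul mul unit n w \<Gamma>
    using assms by (simp add: CD_graded_cayley_def CD_graded_cayley_axioms_def)
  show ?thesis
    using weyl_carrier extends_weyl_action_iff weyl_embedding_iso slice_to_affine_iso by metis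
qed

end
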